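(* Let $G$ be a graph on vertex set $\{1,\ldots,n\}$ with adjacency matrix $A=A(G)$, let $\overline A=A(\overline G)=J_n-I_n-A$, and let $$T_G:=\begin{pmatrix}0&\overline A\\ A&0\end{pmatrix}.$$ Then $G$ is split if and only if $\det(zI_{2n}-T_G)$ is a square in $\mathbb Z[z]$.
   Context: All graphs are finite, simple, and nonempty (so $n\ge1$). $I_n$ and $J_n$ are the identity and the all-ones $n\times n$ matrices, and $\overline G$ is the complement of $G$. A graph is split if its vertex set is the disjoint union of a clique and an independent set (either possibly empty). *)

theory Defs
  imports
    "Graph_Theory.Pair_Digraph"
    "Jordan_Normal_Form.Char_Poly"
    "HOL-Computational_Algebra.Nth_Powers"
begin

(* A finite simple graph is a pair_graph: a loop-free symmetric digraph whose arcs are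
   ordered pairs, so that each edge uv is represented by both (u, v) and (v, u). *)

definition compl_graph :: "'a pair_pre_digraph \<Rightarrow> 'a pair_pre_digraph" where
  "compl_graph G = \<lparr> pverts = pverts G,
     parcs = {(u, v). u \<in> pverts G \<and> v \<in> pverts G \<and> u \<noteq> v \<and> (u, v) \<notin> parcs G} \<rparr>"

definition clique :: "'a pair_pre_digraph \<Rightarrow> 'a set \<Rightarrow> bool" where
  "clique G K \<longleftrightarrow> K \<subseteq> pverts G \<and> (\<forall>u\<in>K. \<forall>v\<in>K. u \<noteq> v \<longrightarrow> (u, v) \<in> parcs G)"

definition independent_set :: "'a pair_pre_digraph \<Rightarrow> 'a set \<Rightarrow> bool" where
  "independent_set G S \<longleftrightarrow> S \<subseteq> pverts G \<and> (\<forall>u\<in>S. \<forall>v\<in>S. (u, v) \<notin> parcs G)"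

definition split_graph :: "'a pair_pre_digraph \<Rightarrow> bool" where
  "split_graph G \<longleftrightarrow>
     (\<exists>K S. pverts G = K \<union> S \<and> K \<inter> S = {} \<and> clique G K \<and> independent_set G S)"

(* The vertices are 1, ..., n, whereas matrix indices start at 0: row i belongs to vertex i + 1. *)
definition adj_mat :: "nat \<Rightarrow> nat pair_pre_digraph \<Rightarrow> int mat" where
  "adj_mat n G = mat n n (\<lambda>(i, j). if (i + 1, j + 1) \<in> parcs G then 1 else 0)"

definition T_mat :: "nat \<Rightarrow> nat pair_pre_digraph \<Rightarrow> int mat" where
  "T_mat n G =
     four_block_mat (0\<^sub>m n n)   (adj_mat n (compl_graph G))
                    (adj_mat n G)  (0\<^sub>m n n)"

lemma pair_graph_compl_graph:
  assumes "pair_graph G"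
  shows "pair_graph (compl_graph G)"
proof -
  interpret pair_graph G by fact
  have "finite (parcs (compl_graph G))"
    by (rule finite_subset[of _ "pverts G \<times> pverts G"]) (auto simp: compl_graph_def)
  moreover have "(v, u) \<in> parcs G \<longleftrightarrow> (u, v) \<in> parcs G" for u v
    using arcs_symmetric by blast
  ultimately show ?thesis
    by unfold_locales (auto simp: compl_graph_def symmetric_def sym_def)
qed

lemma adj_mat_compl_graph:
  assumes "pair_graph G" and "pverts G = {1..n}"
  shows "adj_mat n (compl_graph G) = mat n n (\<lambda>_. 1) - 1\<^sub>m n - adj_mat n G"
proof -
  interpret pair_graph G by fact
  show ?thesis
    by (rule eq_matI) (auto simp: adj_mat_def compl_graph_def assms(2) dest: no_loops')
qed

lemma char_poly_T_mat:
  "char_poly (T_mat n G) = det ([:0, 1:] \<cdot>\<^sub>m 1\<^sub>m (2 * n) - map_mat (\<lambda>a. [:a:]) (T_mat n G))"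
  unfolding char_poly_def char_poly_matrix_def
  by (rule arg_cong[where f = det], rule eq_matI) (auto simp: T_mat_def adj_mat_def mult_2)

end

theory Submission
  imports Defs "HOL-Analysis.Function_Topology"
begin

text \<open>
  Being split is a 2-satisfiability problem with one variable ``\<open>v\<close> lies in the clique'' per
  vertex: an edge demands that one of its ends is in the clique, a non-edge that one of its ends
  is not. The implication digraph of this problem has the literals as its vertices, and its adjacency
  matrix is exactly \<open>T\<^sub>G\<close>. Negation of literals reverses all its arcs (contraposition).

  Suppose the digraph is not strongly connected. Then some nonempty closed set of literals contains
  no complementary pair (\<open>reducible_consistent_closed_set\<close>). Its literals and their
  negations form two diagonal blocks of \<open>T\<^sub>G\<close> that are transposes of one another, so
  removing their vertices divides the characteristic polynomial by a square; it also does not affect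
  whether the graph is split (\<open>split_off_consistent_literals\<close>).

  Repeating this ends in one of two ways. Either no vertex is left, where the polynomial is 1 and the
  empty graph is split. Or the implication digraph is strongly connected on a nonempty set of
  vertices. Then the graph is not split, because a variable and its negation imply each other
  (\<open>irreducible_not_split_on\<close>). The polynomial is not a square either, because an
  irreducible nonnegative matrix has, by Perron and Frobenius, a simple real eigenvalue
  (\<open>simple_Perron_root\<close>).
\<close>

section \<open>Perron eigenvectors of irreducible nonnegative matrices\<close>

text \<open>
  This is strong connectedness of the digraph with an arc from \<^term>\<open>i\<close> to \<^term>\<open>j\<close> for every
  nonzero entry, phrased by closed sets so that no paths have to be handled. A single index is
  irreducible even if its entry is zero.
\<close>

definition irreducible_on :: "'a set \<Rightarrow> ('a \<Rightarrow> 'a \<Rightarrow> 'b::zero) \<Rightarrow> bool" where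
  "irreducible_on I t \<longleftrightarrow>
     (\<forall>Z\<subseteq>I. Z \<noteq> {} \<longrightarrow> (\<forall>i\<in>Z. \<forall>j\<in>I. t i j \<noteq> 0 \<longrightarrow> j \<in> Z) \<longrightarrow> Z = I)"

lemma irreducible_onD:
  assumes "irreducible_on I t" "Z \<subseteq> I" "z \<in> Z"
    and "\<And>i j. i \<in> Z \<Longrightarrow> j \<in> I \<Longrightarrow> t i j \<noteq> 0 \<Longrightarrow> j \<in> Z"
  shows "Z = I"
  using assms unfolding irreducible_on_def by (metis empty_iff)

lemma irreducible_on_transpose:
  assumes "irreducible_on I t"
  shows "irreducible_on I (\<lambda>i j. t j i)"
  unfolding irreducible_on_def
proof (intro allI impI)
  fix Z assume Z: "Z \<subseteq> I" "Z \<noteq> {}" and closed: "\<forall>i\<in>Z. \<forall>j\<in>I. t j i \<noteq> 0 \<longrightarrow> j \<in> Z"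
  show "Z = I"
  proof (rule ccontr)
    assume "Z \<noteq> I"
    then obtain z where "z \<in> I - Z" using Z by blast
    have "I - Z = I"
      by (rule irreducible_onD[OF assms _ \<open>z \<in> I - Z\<close>]) (use Z closed in blast)+
    then show False using Z by blast
  qed
qed

abbreviation mult_on :: "'a set \<Rightarrow> ('a \<Rightarrow> 'a \<Rightarrow> real) \<Rightarrow> ('a \<Rightarrow> real) \<Rightarrow> 'a \<Rightarrow> real" where
  "mult_on I t y i \<equiv> (\<Sum>j\<in>I. t i j * y j)"

text \<open>
  Where a nonnegative eigenvector vanishes, the eigenvalue equation is a sum of nonnegative terms
  equal to zero, so the vector also vanishes at all out-neighbours; the zero set is closed.
\<close>

lemma nonneg_eigenvector_pos:
  assumes I: "finite I" and nn: "\<And>i j. i \<in> I \<Longrightarrow> j \<in> I \<Longrightarrow> t i j \<ge> 0"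
    and irr: "irreducible_on I t"
    and y: "\<And>i. i \<in> I \<Longrightarrow> y i \<ge> 0" and k: "k \<in> I" "y k \<noteq> 0"
    and ev: "\<And>i. i \<in> I \<Longrightarrow> mult_on I t y i = l * y i"
    and i: "i \<in> I"
  shows "y i > 0"
proof (rule ccontr)
  assume "\<not> y i > 0"
  then have "y i = 0" using y[OF i] by simp
  have "{i \<in> I. y i = 0} = I"
  proof (rule irreducible_onD[OF irr, of _ i])
    fix a b assume a: "a \<in> {i \<in> I. y i = 0}" and b: "b \<in> I" "t a b \<noteq> 0"
    then have "mult_on I t y a = 0" using ev[of a] by simp
    then have "t a b * y b = 0"
      using sum_nonneg_eq_0_iff[OF I, of "\<lambda>j. t a j * y j"] a b nn y by auto
    then show "b \<in> {i \<in> I. y i = 0}" using b by auto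
  qed (use i \<open>y i = 0\<close> in auto)
  then show False using k by blast
qed

text \<open>
  The largest \<^term>\<open>l\<close> with \<open>t y \<ge> l y\<close> for some nonzero \<open>y \<ge> 0\<close> is the candidate for
  the Perron root. It is attained by compactness: scaling brings \<^term>\<open>y\<close> into the standard
  simplex, and there the sum of all entries of \<^term>\<open>t\<close> bounds \<^term>\<open>l\<close>.
\<close>

lemma Collatz_Wielandt_maximum:
  fixes t :: "'a \<Rightarrow> 'a \<Rightarrow> real"
  assumes I: "finite I" "I \<noteq> {}" and nn: "\<And>i j. i \<in> I \<Longrightarrow> j \<in> I \<Longrightarrow> t i j \<ge> 0"
  obtains l y where "l \<ge> 0" "\<And>i. i \<in> I \<Longrightarrow> y i \<ge> 0" "\<exists>i\<in>I. y i \<noteq> 0"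
    "\<And>i. i \<in> I \<Longrightarrow> l * y i \<le> mult_on I t y i"
    "\<And>m x. (\<And>i. i \<in> I \<Longrightarrow> x i \<ge> 0) \<Longrightarrow> \<exists>i\<in>I. x i \<noteq> 0 \<Longrightarrow>
       (\<And>i. i \<in> I \<Longrightarrow> m * x i \<le> mult_on I t x i) \<Longrightarrow> m \<le> l"
proof -
  define B where "B = (\<Sum>i\<in>I. \<Sum>j\<in>I. t i j)"
  have B: "B \<ge> 0" unfolding B_def by (intro sum_nonneg nn)
  \<comment> \<open>The simplex lies in this cube; the coordinates outside \<^term>\<open>I\<close> are pinned to 0 to keep it compact.\<close>
  define C where "C = (PiE UNIV (\<lambda>i. if i \<in> I then {0..1} else {0::real}))"
  define S where "S = ({0..B} \<times> C) \<inter>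
     {p. (\<Sum>i\<in>I. snd p i) = 1 \<and> (\<forall>i\<in>I. fst p * snd p i \<le> mult_on I t (snd p) i)}"
  have compact_C: "compact C"
  proof -
    have "compactin (product_topology (\<lambda>i. euclidean) UNIV) C"
      unfolding C_def compactin_PiE by (auto simp: compactin_euclidean_iff)
    then show ?thesis by (simp add: euclidean_product_topology)
  qed
  have coord: "continuous_on UNIV (\<lambda>p :: real \<times> ('a \<Rightarrow> real). snd p i)" for i
    by (rule continuous_on_product_then_coordinatewise) (intro continuous_intros)
  have "closed ({p :: real \<times> ('a \<Rightarrow> real). (\<Sum>i\<in>I. snd p i) = 1} \<inter>
      (\<Inter>i\<in>I. {p. fst p * snd p i \<le> mult_on I t (snd p) i}))"
    by (intro closed_Int closed_INT ballI closed_Collect_eq closed_Collect_le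
        continuous_intros coord)
  also have "\<dots> = {p. (\<Sum>i\<in>I. snd p i) = 1 \<and>
      (\<forall>i\<in>I. fst p * snd p i \<le> mult_on I t (snd p) i)}"
    by auto
  finally have "closed \<dots>" .
  then have "compact S" unfolding S_def
    by (intro compact_Int_closed compact_Times compact_C) auto
  have normalise: "\<exists>y. (m, y) \<in> S" if x: "\<And>i. i \<in> I \<Longrightarrow> x i \<ge> 0" "\<exists>i\<in>I. x i \<noteq> 0"
    and m: "m \<ge> 0" "\<And>i. i \<in> I \<Longrightarrow> m * x i \<le> mult_on I t x i" for m x
  proof -
    define s where "s = (\<Sum>i\<in>I. x i)"
    have s: "s > 0" unfolding s_def
      using x I by (metis less_eq_real_def sum_nonneg sum_nonneg_eq_0_iff)
    define y where "y i = (if i \<in> I then x i / s else 0)" for i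
    have y_out: "y i = 0" if "i \<notin> I" for i using that by (simp add: y_def)
    have y0: "y i \<ge> 0" for i unfolding y_def using x s by auto
    have y1: "(\<Sum>i\<in>I. y i) = 1"
      using s by (simp add: y_def s_def flip: sum_divide_distrib)
    have yle: "y i \<le> 1" if "i \<in> I" for i
      using member_le_sum[OF that, of y] y0 y1 I by simp
    have my: "m * y i \<le> mult_on I t y i" if "i \<in> I" for i
    proof -
      have "mult_on I t y i = mult_on I t x i / s"
        by (simp add: y_def sum_divide_distrib)
      then show ?thesis using m(2)[OF that] s that by (simp add: y_def divide_right_mono)
    qed
    have "m = (\<Sum>i\<in>I. m * y i)" by (simp add: y1 flip: sum_distrib_left)
    also have "\<dots> \<le> (\<Sum>i\<in>I. mult_on I t y i)" by (intro sum_mono my)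
    also have "\<dots> \<le> B" unfolding B_def
      by (intro sum_mono) (use nn y0 yle in \<open>auto intro: mult_left_le\<close>)
    finally have "m \<le> B" .
    have "(m, y) \<in> S"
    proof -
      have "y \<in> C" unfolding C_def using y0 yle by (auto simp: y_out)
      with \<open>m \<le> B\<close> show ?thesis unfolding S_def using m(1) y1 my by simp
    qed
    then show "\<exists>y. (m, y) \<in> S" by (intro exI[of _ y])
  qed
  have "\<exists>y. (0, y) \<in> S"
    by (rule normalise[of "\<lambda>_. 1"]) (use I nn in \<open>auto intro: sum_nonneg\<close>)
  then have "S \<noteq> {}" by blast
  have "continuous_on S fst" by (intro continuous_intros)
  from continuous_attains_sup[OF \<open>compact S\<close> \<open>S \<noteq> {}\<close> this]
  obtain p where p: "p \<in> S" "\<And>q. q \<in> S \<Longrightarrow> fst q \<le> fst p" by blast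
  show ?thesis
  proof (rule that[of "fst p" "snd p"])
    show "\<exists>i\<in>I. snd p i \<noteq> 0"
    proof (rule ccontr)
      assume "\<not> (\<exists>i\<in>I. snd p i \<noteq> 0)"
      then have "(\<Sum>i\<in>I. snd p i) = 0" by simp
      then show False using p(1) by (simp add: S_def)
    qed
    show "m \<le> fst p" if x: "\<And>i. i \<in> I \<Longrightarrow> x i \<ge> 0" "\<exists>i\<in>I. x i \<noteq> 0"
      and "\<And>i. i \<in> I \<Longrightarrow> m * x i \<le> mult_on I t x i" for m x
    proof (cases "m \<ge> 0")
      case True
      then show ?thesis using normalise[OF x True] that p(2) by fastforce
    next
      case False
      then show ?thesis using p(1) by (auto simp: S_def)
    qed
  qed (use p(1) in \<open>auto simp: S_def C_def PiE_def Pi_def split: if_splits\<close>)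
qed

text \<open>
  A maximiser with \<open>t y \<noteq> l y\<close> would have positive slack \<open>t y - l y\<close> somewhere. Replacing
  \<^term>\<open>y\<close> by \<open>y + t y\<close> adds to the slack its image under \<^term>\<open>t\<close>, so positivity spreads to the
  in-neighbours and, by irreducibility, eventually to every index; but then \<^term>\<open>l\<close> could be increased.
\<close>

theorem Perron_eigenvector:
  fixes t :: "'a \<Rightarrow> 'a \<Rightarrow> real"
  assumes I: "finite I" "I \<noteq> {}" and nn: "\<And>i j. i \<in> I \<Longrightarrow> j \<in> I \<Longrightarrow> t i j \<ge> 0"
    and irr: "irreducible_on I t"
  obtains l v where "\<And>i. i \<in> I \<Longrightarrow> v i > 0" "\<And>i. i \<in> I \<Longrightarrow> mult_on I t v i = l * v i"
proof -
  obtain l y where l: "l \<ge> 0" and y: "\<And>i. i \<in> I \<Longrightarrow> y i \<ge> 0" "\<exists>i\<in>I. y i \<noteq> 0"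
    "\<And>i. i \<in> I \<Longrightarrow> l * y i \<le> mult_on I t y i"
    and max: "\<And>m x. (\<And>i. i \<in> I \<Longrightarrow> x i \<ge> 0) \<Longrightarrow> \<exists>i\<in>I. x i \<noteq> 0 \<Longrightarrow>
       (\<And>i. i \<in> I \<Longrightarrow> m * x i \<le> mult_on I t x i) \<Longrightarrow> m \<le> l"
    using Collatz_Wielandt_maximum[where t = t, OF I nn] by blast
  define slack where "slack x i = mult_on I t x i - l * x i" for x i
  have no_slack: False
    if x: "\<And>i. i \<in> I \<Longrightarrow> x i \<ge> 0" "\<exists>i\<in>I. x i \<noteq> 0" "\<And>i. i \<in> I \<Longrightarrow> slack x i \<ge> 0"
      and e: "e \<in> I" "slack x e > 0" for x e
    using x e
  proof (induction "card {i \<in> I. slack x i = 0}" arbitrary: x rule: less_induct)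
    case (less x)
    show False
    proof (cases "\<forall>i\<in>I. slack x i > 0")
      case True
      define d where "d = Min ((\<lambda>i. slack x i / (x i + 1)) ` I)"
      have "d > 0" unfolding d_def using I True less.prems(1)
        by (subst Min_gr_iff) (auto intro!: divide_pos_pos add_nonneg_pos)
      have "l + d \<le> l"
      proof (rule max[OF less.prems(1,2)])
        fix i assume i: "i \<in> I"
        then have "d \<le> slack x i / (x i + 1)" unfolding d_def using I by (intro Min_le) auto
        then have "d * (x i + 1) \<le> slack x i"
          using less.prems(1)[OF i] by (simp add: pos_le_divide_eq)
        then show "(l + d) * x i \<le> mult_on I t x i"
          using \<open>d > 0\<close> by (simp add: slack_def algebra_simps)
      qed
      then show False using \<open>d > 0\<close> by simp
    next
      case False
      define Z where "Z = {i \<in> I. slack x i = 0}"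
      have Z: "Z \<subseteq> I" "Z \<noteq> {}" "Z \<noteq> I" unfolding Z_def
        using False less.prems(3,4,5) by force+
      then obtain a b where ab: "a \<in> Z" "b \<in> I" "b \<notin> Z" "t a b \<noteq> 0"
        using irr unfolding irreducible_on_def by blast
      define x' where "x' i = x i + mult_on I t x i" for i
      have slack': "slack x' i = slack x i + mult_on I t (slack x) i" for i
        by (simp add: slack_def x'_def algebra_simps sum.distrib sum_subtractf sum_distrib_left)
      have mono: "slack x' i \<ge> slack x i" if "i \<in> I" for i
        unfolding slack' using that nn less.prems(3) by (simp add: sum_nonneg)
      have Tx: "mult_on I t x i \<ge> 0" if "i \<in> I" for i
        using that nn less.prems(1) by (simp add: sum_nonneg)
      have "slack x' a > 0"
      proof -
        have "0 < t a b * slack x b"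
        proof (rule mult_pos_pos)
          show "0 < t a b" using ab Z(1) nn[of a b] by force
          show "0 < slack x b" using ab less.prems(3)[of b] by (auto simp: Z_def)
        qed
        also have "\<dots> \<le> mult_on I t (slack x) a"
          using ab Z(1) nn less.prems(3) I by (intro member_le_sum) auto
        also have "\<dots> \<le> slack x' a" unfolding slack' using ab Z(1) less.prems(3) by auto
        finally show ?thesis .
      qed
      have "{i \<in> I. slack x' i = 0} \<subset> {i \<in> I. slack x i = 0}"
      proof
        show "{i \<in> I. slack x' i = 0} \<subseteq> {i \<in> I. slack x i = 0}"
        proof
          fix i assume "i \<in> {i \<in> I. slack x' i = 0}"
          then show "i \<in> {i \<in> I. slack x i = 0}"
            using mono[of i] less.prems(3)[of i] by simp
        qed
        show "{i \<in> I. slack x' i = 0} \<noteq> {i \<in> I. slack x i = 0}"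
          using \<open>slack x' a > 0\<close> ab(1) unfolding Z_def set_eq_iff by force
      qed
      then have "card {i \<in> I. slack x' i = 0} < card {i \<in> I. slack x i = 0}"
        using I by (intro psubset_card_mono) auto
      then show False
      proof (rule less.hyps)
        show "x' i \<ge> 0" if "i \<in> I" for i
          using less.prems(1)[OF that] Tx[OF that] by (simp add: x'_def)
        show "\<exists>i\<in>I. x' i \<noteq> 0"
        proof -
          from less.prems(2) obtain k where "k \<in> I" "x k \<noteq> 0" by blast
          then show ?thesis
            using less.prems(1)[of k] Tx[of k] by (intro bexI[of _ k]) (auto simp: x'_def)
        qed
        show "slack x' i \<ge> 0" if "i \<in> I" for i
          using mono[OF that] less.prems(3)[OF that] by linarith
        show "e \<in> I" "slack x' e > 0" using less.prems(4,5) mono[of e] by auto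
      qed
    qed
  qed
  have ev: "mult_on I t y i = l * y i" if "i \<in> I" for i
  proof (rule ccontr)
    assume "mult_on I t y i \<noteq> l * y i"
    then have "slack y i > 0" using y(3)[OF that] by (simp add: slack_def)
    moreover have "slack y j \<ge> 0" if "j \<in> I" for j
      using y(3)[OF that] by (simp add: slack_def)
    ultimately show False using no_slack[of y i] y(1,2) that by blast
  qed
  from y(2) obtain k where k: "k \<in> I" "y k \<noteq> 0" by blast
  show ?thesis
  proof (rule that[of y l])
    show "y i > 0" if "i \<in> I" for i
      by (rule nonneg_eigenvector_pos[OF I(1) nn irr y(1) k ev that])
  qed (fact ev)
qed

text \<open>
  The eigenspace of a positive eigenvector \<^term>\<open>v\<close> is one-dimensional: an eigenvector
  \<^term>\<open>w\<close> of the same eigenvalue that vanishes at some index is zero. If \<^term>\<open>w\<close> had a positive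
  entry, the largest \<^term>\<open>c\<close> with \<open>v - c w \<ge> 0\<close> would give a nonnegative eigenvector that is
  nonzero but not positive. Hence \<open>w \<le> 0\<close>, and the same holds for \<open>- w\<close>.
\<close>

lemma Perron_eigenvector_unique_aux:
  fixes t :: "'a \<Rightarrow> 'a \<Rightarrow> real"
  assumes I: "finite I" and nn: "\<And>i j. i \<in> I \<Longrightarrow> j \<in> I \<Longrightarrow> t i j \<ge> 0"
    and irr: "irreducible_on I t"
    and v_pos: "\<And>i. i \<in> I \<Longrightarrow> v i > 0"
    and v_ev: "\<And>i. i \<in> I \<Longrightarrow> mult_on I t v i = l * v i"
    and w_ev: "\<And>i. i \<in> I \<Longrightarrow> mult_on I t w i = l * w i"
    and h: "h \<in> I" and wh: "w h = 0" and k: "k \<in> I"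
  shows "w k \<le> 0"
proof (rule ccontr)
  assume "\<not> w k \<le> 0"
  define J where "J = {i \<in> I. w i > 0}"
  have J: "finite J" "J \<noteq> {}" using I k \<open>\<not> w k \<le> 0\<close> by (auto simp: J_def)
  define c where "c = Min ((\<lambda>i. v i / w i) ` J)"
  have "c \<in> (\<lambda>i. v i / w i) ` J" unfolding c_def using J by (intro Min_in) auto
  then obtain a where a: "a \<in> J" "c = v a / w a" by blast
  have "c > 0" using a v_pos by (auto simp: J_def)
  define y where "y i = v i - c * w i" for i
  have "y i \<ge> 0" if i: "i \<in> I" for i
  proof (cases "w i > 0")
    case True
    then have "c \<le> v i / w i" unfolding c_def using J i by (intro Min_le) (auto simp: J_def)
    then show ?thesis using True by (simp add: y_def pos_le_divide_eq)
  next
    case False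
    then have "c * w i \<le> 0" using \<open>c > 0\<close> by (simp add: mult_le_0_iff)
    then show ?thesis using v_pos[OF i] by (simp add: y_def)
  qed
  moreover have "mult_on I t y i = l * y i" if i: "i \<in> I" for i
  proof -
    have "mult_on I t y i = mult_on I t v i - c * mult_on I t w i"
      by (simp add: y_def algebra_simps sum_subtractf sum_distrib_left)
    then show ?thesis using v_ev[OF i] w_ev[OF i] by (simp add: y_def algebra_simps)
  qed
  moreover have "y h \<noteq> 0" using v_pos[OF h] wh by (simp add: y_def)
  ultimately have "y a > 0"
    using nonneg_eigenvector_pos[of I t y h l a] I nn irr h a(1) by (auto simp: J_def)
  then show False using a by (simp add: y_def J_def)
qed

lemma Perron_eigenvector_unique:
  fixes t :: "'a \<Rightarrow> 'a \<Rightarrow> real"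
  assumes I: "finite I" and nn: "\<And>i j. i \<in> I \<Longrightarrow> j \<in> I \<Longrightarrow> t i j \<ge> 0"
    and irr: "irreducible_on I t"
    and v_pos: "\<And>i. i \<in> I \<Longrightarrow> v i > 0"
    and v_ev: "\<And>i. i \<in> I \<Longrightarrow> mult_on I t v i = l * v i"
    and w_ev: "\<And>i. i \<in> I \<Longrightarrow> mult_on I t w i = l * w i"
    and h: "h \<in> I" and wh: "w h = 0" and k: "k \<in> I"
  shows "w k = 0"
proof (rule antisym)
  note aux = Perron_eigenvector_unique_aux[where t = t, OF I nn irr v_pos v_ev _ h _ k]
  show "w k \<le> 0" by (rule aux) (use w_ev wh in auto)
  have "- w k \<le> 0" by (rule aux[of "\<lambda>i. - w i"]) (use w_ev wh in \<open>auto simp: sum_negf\<close>)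
  then show "0 \<le> w k" by simp
qed

section \<open>Characteristic polynomials of matrices indexed by lists\<close>

text \<open>
  Indexing by a list of arbitrary labels makes block decompositions and simultaneous permutations
  of rows and columns operations on lists.
\<close>

definition list_mat :: "'a list \<Rightarrow> ('a \<Rightarrow> 'a \<Rightarrow> 'b) \<Rightarrow> 'b mat" where
  "list_mat xs f = mat (length xs) (length xs) (\<lambda>(i, j). f (xs ! i) (xs ! j))"

lemma list_mat_carrier [simp]: "list_mat xs f \<in> carrier_mat (length xs) (length xs)"
  by (simp add: list_mat_def)

lemma list_mat_index [simp]:
  "i < length xs \<Longrightarrow> j < length xs \<Longrightarrow> list_mat xs f $$ (i, j) = f (xs ! i) (xs ! j)"
  by (simp add: list_mat_def)

lemma list_mat_dim [simp]:
  "dim_row (list_mat xs f) = length xs" "dim_col (list_mat xs f) = length xs"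
  by (simp_all add: list_mat_def)

definition list_char_poly :: "'a list \<Rightarrow> ('a \<Rightarrow> 'a \<Rightarrow> 'b::comm_ring_1) \<Rightarrow> 'b poly" where
  "list_char_poly xs t = char_poly (list_mat xs t)"

lemma list_char_poly_nonzero [simp]: "list_char_poly xs t \<noteq> 0"
  using degree_monic_char_poly[of "list_mat xs t" "length xs"]
  unfolding list_char_poly_def by force

lemma list_char_poly_transpose: "list_char_poly xs (\<lambda>i j. t j i) = list_char_poly xs t"
proof -
  have "list_mat xs (\<lambda>i j. t j i) = transpose_mat (list_mat xs t)"
    by (rule eq_matI) auto
  then show ?thesis
    by (simp add: list_char_poly_def char_poly_transpose_mat[of _ "length xs"])
qed

lemma list_char_poly_map: "list_char_poly (map g xs) t = list_char_poly xs (\<lambda>i j. t (g i) (g j))"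
proof -
  have "list_mat (map g xs) t = list_mat xs (\<lambda>i j. t (g i) (g j))"
    by (rule eq_matI) auto
  then show ?thesis by (simp add: list_char_poly_def)
qed

lemma list_char_poly_perm:
  fixes t :: "'a \<Rightarrow> 'a \<Rightarrow> 'b::comm_ring_1"
  assumes "mset xs = mset ys"
  shows "list_char_poly xs t = list_char_poly ys t"
proof -
  obtain p where p: "p permutes {..<length ys}" "permute_list p ys = xs"
    using mset_eq_permutation[OF assms] by blast
  have len: "length xs = length ys" using p(2) by auto
  have nth: "xs ! i = ys ! p i" if "i < length ys" for i
    using permute_list_nth[OF p(1) that] p(2) by simp
  have p_less: "p i < length ys" if "i < length ys" for i
    using permutes_in_image[OF p(1), of i] that by simp
  have p_inj: "p i = p j \<longleftrightarrow> i = j" for i j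
    using permutes_inj[OF p(1)] by (auto dest: injD)
  have p': "p permutes {0..<length ys}" using p(1) by (simp add: atLeast0LessThan)
  define n where "n = length ys"
  define M where "M = char_poly_matrix (list_mat ys t)"
  have M: "M \<in> carrier_mat n n" unfolding M_def n_def by simp
  define R where "R = mat n n (\<lambda>(i, j). M $$ (p i, j))"
  have R: "R \<in> carrier_mat n n" unfolding R_def by simp
  define C where "C = mat n n (\<lambda>(i, j). R\<^sup>T $$ (p i, j))"
  have "char_poly_matrix (list_mat xs t) = C\<^sup>T"
    by (rule eq_matI) (auto simp: C_def R_def M_def n_def char_poly_matrix_def len nth p_less p_inj)
  then have "list_char_poly xs t = det (C\<^sup>T)"
    by (simp add: list_char_poly_def char_poly_def)
  also have "\<dots> = det C" by (rule det_transpose[of _ n]) (simp add: C_def)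
  also have "\<dots> = signof p * det (R\<^sup>T)"
    unfolding C_def by (rule det_permute_rows) (use R p' n_def in auto)
  also have "det (R\<^sup>T) = det R" by (rule det_transpose[OF R])
  also have "det R = signof p * det M"
    unfolding R_def by (rule det_permute_rows[OF M]) (use p' n_def in auto)
  also have "signof p * (signof p * det M) = det M"
    by (simp add: sign_def)
  finally show ?thesis by (simp add: M_def list_char_poly_def char_poly_def)
qed

lemma list_char_poly_append:
  fixes t :: "'a \<Rightarrow> 'a \<Rightarrow> 'b::idom"
  assumes zero: "\<And>x y. x \<in> set xs \<Longrightarrow> y \<in> set ys \<Longrightarrow> t y x = 0"
  shows "list_char_poly (xs @ ys) t = list_char_poly xs t * list_char_poly ys t"
proof -
  define n m where "n = length xs" and "m = length ys"
  define U where "U = mat n m (\<lambda>(i, j). [:- t (xs ! i) (ys ! j):])"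
  have "char_poly_matrix (list_mat (xs @ ys) t) =
      four_block_mat (char_poly_matrix (list_mat xs t)) U (0\<^sub>m m n)
        (char_poly_matrix (list_mat ys t))"
    by (rule eq_matI)
      (auto simp: char_poly_matrix_def U_def n_def m_def nth_append zero)
  then show ?thesis
    unfolding list_char_poly_def char_poly_def
    by (simp add: det_four_block_mat_lower_left_zero[of _ n _ m] n_def m_def U_def)
qed

section \<open>Simplicity of the Perron root\<close>

text \<open>
  The characteristic matrix is made to show its root in one column: replacing the first column by
  the combination of columns with coefficients \<^term>\<open>v\<close>, a positive right eigenvector for
  \<^term>\<open>l\<close>, turns that column into \<open>(x - l) v\<close>. Pulling out the factor leaves a matrix
  \<open>Y\<close> with first column \<^term>\<open>v\<close>, which must be nonsingular at \<^term>\<open>l\<close>. A kernel vector there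
  reads \<open>c v + (l - t) z = 0\<close> with \<^term>\<open>z\<close> vanishing at the first index. Pairing with a
  positive left eigenvector kills the second term, so \<open>c = 0\<close>; then \<^term>\<open>z\<close> is an eigenvector
  with a zero entry, hence zero.
\<close>

lemma simple_Perron_root:
  fixes t :: "'a \<Rightarrow> 'a \<Rightarrow> real"
  assumes xs: "distinct xs" "xs \<noteq> []"
    and nn: "\<And>i j. i \<in> set xs \<Longrightarrow> j \<in> set xs \<Longrightarrow> t i j \<ge> 0"
    and irr: "irreducible_on (set xs) t"
  obtains l p where "list_char_poly xs t = [:- l, 1:] * p" "poly p l \<noteq> 0"
proof -
  let ?I = "set xs" and ?n = "length xs"
  have ne: "?I \<noteq> {}" using xs(2) by simp
  obtain l v where v: "\<And>i. i \<in> ?I \<Longrightarrow> v i > 0"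
    and v_ev: "\<And>i. i \<in> ?I \<Longrightarrow> mult_on ?I t v i = l * v i"
    using Perron_eigenvector[where t = t, OF finite_set ne nn irr] by metis
  obtain m u where u: "\<And>i. i \<in> ?I \<Longrightarrow> u i > 0"
    and u_ev: "\<And>i. i \<in> ?I \<Longrightarrow> mult_on ?I (\<lambda>i j. t j i) u i = m * u i"
    using Perron_eigenvector[where t = "\<lambda>i j. t j i", OF finite_set ne nn irreducible_on_transpose[OF irr]]
    by metis
  have uv: "(\<Sum>i\<in>?I. u i * v i) > 0"
    using u v xs(2) by (intro sum_pos) auto
  have dual: "(\<Sum>i\<in>?I. u i * mult_on ?I t w i) = m * (\<Sum>i\<in>?I. u i * w i)" for w
  proof -
    have "(\<Sum>i\<in>?I. u i * mult_on ?I t w i) = (\<Sum>j\<in>?I. \<Sum>i\<in>?I. u i * (t i j * w j))"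
      by (subst sum.swap) (simp add: sum_distrib_left)
    also have "\<dots> = (\<Sum>j\<in>?I. mult_on ?I (\<lambda>i j. t j i) u j * w j)"
      by (simp only: sum_distrib_right sum_distrib_left mult_ac)
    also have "\<dots> = m * (\<Sum>i\<in>?I. u i * w i)"
      using u_ev by (simp add: sum_distrib_left mult_ac)
    finally show ?thesis .
  qed
  have "m = l"
  proof -
    have "m * (\<Sum>i\<in>?I. u i * v i) = (\<Sum>i\<in>?I. u i * (l * v i))"
      using dual[of v] v_ev by simp
    also have "\<dots> = l * (\<Sum>i\<in>?I. u i * v i)"
      by (simp add: sum_distrib_left algebra_simps)
    finally show ?thesis using uv by simp
  qed
  define h where "h = xs ! 0"
  have h: "h \<in> ?I" unfolding h_def using xs(2) by simp
  have n: "0 < ?n" using xs(2) by simp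
  have reindex: "(\<Sum>k<?n. f (xs ! k)) = (\<Sum>i\<in>?I. f i)" for f :: "'a \<Rightarrow> real"
    using xs(1) by (simp add: sum.distinct_set_conv_list sum_list_sum_nth atLeast0LessThan)
  have const_poly_sum: "(\<Sum>k<m. [:f k:]) = [:\<Sum>k<m. f k:]" for f :: "nat \<Rightarrow> real" and m :: nat
    by (induction m) auto
  define X where "X = char_poly_matrix (list_mat xs t)"
  have X: "X \<in> carrier_mat ?n ?n" unfolding X_def by simp
  have X_index: "X $$ (i, j) = (if i = j then [:- t (xs ! i) (xs ! j), 1:] else [:- t (xs ! i) (xs ! j):])"
    if "i < ?n" "j < ?n" for i j
    using that by (auto simp: X_def char_poly_matrix_def)
  define Q where "Q = mat ?n ?n (\<lambda>(i, j). if j = 0 then [:v (xs ! i):] else if i = j then 1 else 0)"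
  define Y where "Y = mat ?n ?n (\<lambda>(i, j). if j = 0 then [:v (xs ! i):] else X $$ (i, j))"
  define D where "D = mat ?n ?n (\<lambda>(i, j). if i = j then if j = 0 then [:- l, 1:] else 1 else 0)"
  have Q: "Q \<in> carrier_mat ?n ?n" and Y: "Y \<in> carrier_mat ?n ?n" and D: "D \<in> carrier_mat ?n ?n"
    unfolding Q_def Y_def D_def by simp_all
  \<comment> \<open>\<^term>\<open>Q\<close> performs the column combination, and \<^term>\<open>D\<close> puts the factor of the first column back.\<close>
  have "X * Q = Y * D"
  proof (rule eq_matI)
    fix i j assume "i < dim_row (Y * D)" "j < dim_col (Y * D)"
    then have i: "i < ?n" and j: "j < ?n" using Y D by auto
    have XQ: "(X * Q) $$ (i, j) = (\<Sum>k<?n. X $$ (i, k) * Q $$ (k, j))"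
      using X Q i j by (simp add: scalar_prod_def atLeast0LessThan)
    have YD: "(Y * D) $$ (i, j) = (\<Sum>k<?n. Y $$ (i, k) * D $$ (k, j))"
      using Y D i j by (simp add: scalar_prod_def atLeast0LessThan)
    show "(X * Q) $$ (i, j) = (Y * D) $$ (i, j)"
    proof (cases "j = 0")
      case True
      have "(X * Q) $$ (i, j) =
          (\<Sum>k<?n. (if k = i then [:0, v (xs ! i):] else 0) + [:- (t (xs ! i) (xs ! k) * v (xs ! k)):])"
        unfolding XQ using True i n by (intro sum.cong) (auto simp: X_index Q_def)
      also have "\<dots> = [:0, v (xs ! i):] + (\<Sum>k<?n. [:- (t (xs ! i) (xs ! k) * v (xs ! k)):])"
        using i by (simp add: sum.distrib)
      also have "(\<Sum>k<?n. [:- (t (xs ! i) (xs ! k) * v (xs ! k)):]) =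
          [:- (\<Sum>k<?n. t (xs ! i) (xs ! k) * v (xs ! k)):]"
        by (simp add: const_poly_sum sum_negf)
      also have "(\<Sum>k<?n. t (xs ! i) (xs ! k) * v (xs ! k)) = l * v (xs ! i)"
        using reindex[of "\<lambda>j. t (xs ! i) j * v j"] v_ev[of "xs ! i"] i by simp
      finally have "(X * Q) $$ (i, j) = [:v (xs ! i):] * [:- l, 1:]" by simp
      also have "\<dots> = (\<Sum>k<?n. if k = 0 then [:v (xs ! i):] * [:- l, 1:] else 0)"
        using n by (subst sum.delta) auto
      also have "\<dots> = (Y * D) $$ (i, j)"
        unfolding YD using True i n by (intro sum.cong) (auto simp: Y_def D_def)
      finally show ?thesis .
    next
      case False
      have "(X * Q) $$ (i, j) = (\<Sum>k<?n. if k = j then X $$ (i, j) else 0)"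
        unfolding XQ using False j by (intro sum.cong) (auto simp: Q_def)
      also have "\<dots> = (Y * D) $$ (i, j)"
        unfolding YD using False i j by (intro sum.cong) (auto simp: Y_def D_def)
      finally show ?thesis .
    qed
  qed (use X Q Y D in auto)
  have "det Q = [:v h:]"
  proof -
    have "det Q = prod_list (diag_mat Q)"
      by (rule det_lower_triangular[OF _ Q]) (auto simp: Q_def)
    also have "\<dots> = (\<Prod>i<?n. Q $$ (i, i))"
      using Q by (simp add: prod_list_diag_prod atLeast0LessThan)
    also have "\<dots> = (\<Prod>i<?n. if i = 0 then [:v h:] else 1)"
      by (intro prod.cong) (auto simp: Q_def h_def)
    also have "\<dots> = [:v h:]" using n by (subst prod.delta) auto
    finally show ?thesis .
  qed
  moreover have "det D = [:- l, 1:]"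
  proof -
    have "det D = prod_list (diag_mat D)"
      by (rule det_lower_triangular[OF _ D]) (auto simp: D_def)
    also have "\<dots> = (\<Prod>i<?n. D $$ (i, i))"
      using D by (simp add: prod_list_diag_prod atLeast0LessThan)
    also have "\<dots> = (\<Prod>i<?n. if i = 0 then [:- l, 1:] else 1)"
      by (intro prod.cong) (auto simp: D_def)
    also have "\<dots> = [:- l, 1:]" using n by (subst prod.delta) auto
    finally show ?thesis .
  qed
  ultimately have det: "det X * [:v h:] = det Y * [:- l, 1:]"
    using \<open>X * Q = Y * D\<close> det_mult[OF X Q] det_mult[OF Y D] by simp
  have Yl: "poly (det Y) l \<noteq> 0"
  proof
    assume "poly (det Y) l = 0"
    define Z where "Z = map_mat (\<lambda>p. poly p l) Y"
    have Z: "Z \<in> carrier_mat ?n ?n" using Y by (simp add: Z_def)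
    have "det Z = 0"
      using \<open>poly (det Y) l = 0\<close> poly_det_cong[OF Z Y, of l] Y by (simp add: Z_def)
    then obtain w where w: "w \<in> carrier_vec ?n" "w \<noteq> 0\<^sub>v ?n" "Z *\<^sub>v w = 0\<^sub>v ?n"
      using det_0_iff_vec_prod_zero_field[OF Z] by blast
    define idx where "idx i = (THE k. k < ?n \<and> xs ! k = i)" for i
    have idx: "idx (xs ! k) = k" if "k < ?n" for k
      unfolding idx_def using that xs(1) by (intro the_equality) (auto simp: nth_eq_iff_index_eq)
    define c where "c = w $ 0"
    define z where "z i = (if i = h then 0 else w $ idx i)" for i
    have h_iff: "xs ! k = h \<longleftrightarrow> k = 0" if "k < ?n" for k
      using that n xs(1) by (simp add: h_def nth_eq_iff_index_eq)
    have z: "c * v i + l * z i = mult_on ?I t z i" if "i \<in> ?I" for i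
    proof -
      from that obtain a where a: "a < ?n" "i = xs ! a" by (auto simp: in_set_conv_nth)
      have "0 = (Z *\<^sub>v w) $ a" using w(3) a by simp
      also have "\<dots> = (\<Sum>k<?n. Z $$ (a, k) * w $ k)"
        using Z a w(1) by (simp add: scalar_prod_def atLeast0LessThan)
      also have "\<dots> = (\<Sum>k<?n. (if k = 0 then v i * c else 0) +
          ((if k = a then l * z i else 0) - t i (xs ! k) * z (xs ! k)))"
        using a
        by (intro sum.cong)
          (auto simp: Z_def Y_def X_index c_def z_def h_iff idx algebra_simps)
      also have "\<dots> = v i * c + (l * z i - (\<Sum>k<?n. t i (xs ! k) * z (xs ! k)))"
        using a n by (simp add: sum.distrib sum_subtractf)
      also have "(\<Sum>k<?n. t i (xs ! k) * z (xs ! k)) = mult_on ?I t z i"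
        by (rule reindex)
      finally show ?thesis by (simp add: algebra_simps)
    qed
    have "l * (\<Sum>i\<in>?I. u i * z i) = (\<Sum>i\<in>?I. u i * (c * v i + l * z i))"
      using dual[of z] z \<open>m = l\<close> by simp
    also have "\<dots> = c * (\<Sum>i\<in>?I. u i * v i) + l * (\<Sum>i\<in>?I. u i * z i)"
      by (simp add: algebra_simps sum.distrib sum_distrib_left)
    finally have "c = 0" using uv by simp
    have z0: "z k = 0" if "k \<in> ?I" for k
      by (rule Perron_eigenvector_unique[where t = t and v = v and l = l and h = h and I = ?I])
        (use nn irr v v_ev h that z \<open>c = 0\<close> in \<open>auto simp: z_def\<close>)
    have "w = 0\<^sub>v ?n"
    proof (rule eq_vecI)
      fix k assume "k < dim_vec (0\<^sub>v ?n)"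
      then have k: "k < ?n" by simp
      then show "w $ k = 0\<^sub>v ?n $ k"
        using z0[of "xs ! k"] \<open>c = 0\<close> by (cases "k = 0") (auto simp: z_def h_iff idx c_def)
    qed (use w in auto)
    then show False using w(2) by simp
  qed
  show ?thesis
  proof (rule that[of l "Polynomial.smult (1 / v h) (det Y)"])
    have "Polynomial.smult (v h) (det X) = [:- l, 1:] * det Y"
      using det by (simp add: mult.commute)
    then have "Polynomial.smult (1 / v h) (Polynomial.smult (v h) (det X)) = [:- l, 1:] * Polynomial.smult (1 / v h) (det Y)"
      by (simp only: mult_smult_right)
    then show "list_char_poly xs t = [:- l, 1:] * Polynomial.smult (1 / v h) (det Y)"
      using v[OF h] by (simp add: list_char_poly_def char_poly_def X_def)
    show "poly (Polynomial.smult (1 / v h) (det Y)) l \<noteq> 0" using Yl v[OF h] by simp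
  qed
qed

lemma not_square_of_simple_root:
  fixes p :: "'a::idom poly"
  assumes "poly p l \<noteq> 0"
  shows "\<not> is_square ([:- l, 1:] * p)"
proof
  assume "is_square ([:- l, 1:] * p)"
  then obtain q where q: "[:- l, 1:] * p = q ^ 2" by (elim is_nth_powerE)
  have "poly (q ^ 2) l = 0" by (simp flip: q)
  then have "[:- l, 1:] dvd q" by (simp add: poly_eq_0_iff_dvd)
  then obtain r where "q = [:- l, 1:] * r" by (elim dvdE)
  then have "[:- l, 1:] * p = [:- l, 1:] * ([:- l, 1:] * r ^ 2)"
    using q by (simp only: power2_eq_square mult.assoc mult.left_commute)
  then have "p = [:- l, 1:] * r ^ 2" by (simp only: mult_cancel_left) simp
  then show False using assms by simp
qed

text \<open>
  Every root of a square has even multiplicity, whereas the Perron root is simple. That root need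
  not be an integer, so the polynomials are compared over the reals.
\<close>

lemma irreducible_char_poly_not_square:
  fixes t :: "'a \<Rightarrow> 'a \<Rightarrow> int"
  assumes "distinct xs" "xs \<noteq> []"
    and "\<And>i j. i \<in> set xs \<Longrightarrow> j \<in> set xs \<Longrightarrow> t i j \<ge> 0"
    and "irreducible_on (set xs) t"
  shows "\<not> is_square (list_char_poly xs t)"
proof
  assume "is_square (list_char_poly xs t)"
  then obtain q where q: "list_char_poly xs t = q ^ 2" by (elim is_nth_powerE)
  define t' where "t' i j = real_of_int (t i j)" for i j
  have "irreducible_on (set xs) t'"
    using assms(4) by (simp add: irreducible_on_def t'_def)
  moreover have "t' i j \<ge> 0" if "i \<in> set xs" "j \<in> set xs" for i j
    using assms(3) that by (simp add: t'_def)
  ultimately obtain l p where p: "list_char_poly xs t' = [:- l, 1:] * p" "poly p l \<noteq> 0"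
    using simple_Perron_root[OF assms(1,2), of t'] by metis
  have "list_mat xs t' = map_mat real_of_int (list_mat xs t)"
    by (rule eq_matI) (auto simp: t'_def)
  then have "list_char_poly xs t' = map_poly real_of_int (list_char_poly xs t)"
    by (simp add: list_char_poly_def of_int_hom.char_poly_hom[of _ "length xs"])
  also have "\<dots> = (map_poly real_of_int q) ^ 2"
    unfolding q by (simp add: power2_eq_square of_int_poly_hom.hom_mult)
  finally have "is_square (list_char_poly xs t')" by (rule is_nth_powerI)
  then show False using p not_square_of_simple_root by metis
qed

section \<open>Splittings as satisfying assignments\<close>

text \<open>
  Consider the propositional variable ``\<open>v\<close> lies in the clique'' for each vertex \<open>v\<close>. The pair
  \<open>(v, False)\<close> is its positive literal and \<open>(v, True)\<close> its negation.
\<close>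

definition lits :: "'a list \<Rightarrow> ('a \<times> bool) list" where
  "lits xs = map (\<lambda>v. (v, False)) xs @ map (\<lambda>v. (v, True)) xs"

definition negate :: "'a \<times> bool \<Rightarrow> 'a \<times> bool" where
  "negate x = (fst x, \<not> snd x)"

text \<open>
  A vertex in the clique forces its non-neighbours out of it, and a vertex outside the clique
  forces its neighbours into it. These implications form the digraph whose adjacency matrix is the
  block matrix of the theorem.
\<close>

definition implication :: "('a \<Rightarrow> 'a \<Rightarrow> bool) \<Rightarrow> 'a \<times> bool \<Rightarrow> 'a \<times> bool \<Rightarrow> int" where
  "implication R x y = of_bool (snd x \<noteq> snd y \<and>
     (if snd x then R (fst x) (fst y) else fst x \<noteq> fst y \<and> \<not> R (fst x) (fst y)))"

definition split_on :: "('a \<Rightarrow> 'a \<Rightarrow> bool) \<Rightarrow> 'a set \<Rightarrow> bool" where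
  "split_on R V \<longleftrightarrow> (\<exists>K S. V = K \<union> S \<and> K \<inter> S = {} \<and>
     (\<forall>u\<in>K. \<forall>v\<in>K. u \<noteq> v \<longrightarrow> R u v) \<and> (\<forall>u\<in>S. \<forall>v\<in>S. \<not> R u v))"

lemma negate_negate [simp]: "negate (negate x) = x"
  by (simp add: negate_def)

lemma negate_Pair [simp]: "negate (v, b) = (v, \<not> b)"
  by (simp add: negate_def)

lemma implication_contrapositive:
  assumes "symp R"
  shows "implication R (negate y) (negate x) = implication R x y"
  using assms by (auto simp: implication_def negate_def symp_def)

lemma set_lits: "set (lits xs) = set xs \<times> UNIV"
  by (auto simp: lits_def UNIV_bool)

lemma length_lits [simp]: "length (lits xs) = 2 * length xs"
  by (simp add: lits_def)

lemma lits_nth: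
  assumes "i < 2 * length xs"
  shows "lits xs ! i =
    (if i < length xs then (xs ! i, False) else (xs ! (i - length xs), True))"
  using assms by (simp add: lits_def nth_append)

lemma distinct_lits: "distinct xs \<Longrightarrow> distinct (lits xs)"
  by (auto simp: lits_def distinct_map inj_on_def)

text \<open>
  The literals that are true under a splitting are closed under implication; they are one of each
  complementary pair, hence neither none nor all.
\<close>

lemma irreducible_not_split_on:
  assumes irr: "irreducible_on (V \<times> UNIV) (implication R)" and "V \<noteq> {}"
  shows "\<not> split_on R V"
proof
  assume "split_on R V"
  then obtain K S where V: "V = K \<union> S" "K \<inter> S = {}"
    and K: "\<forall>u\<in>K. \<forall>v\<in>K. u \<noteq> v \<longrightarrow> R u v" and S: "\<forall>u\<in>S. \<forall>v\<in>S. \<not> R u v"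
    unfolding split_on_def by (elim exE conjE)
  obtain v where "v \<in> V" using \<open>V \<noteq> {}\<close> by blast
  have "K \<times> {False} \<union> S \<times> {True} = V \<times> UNIV"
  proof (rule irreducible_onD[OF irr])
    show "(v, v \<in> S) \<in> K \<times> {False} \<union> S \<times> {True}" using V(1) \<open>v \<in> V\<close> by auto
    fix x y
    assume x: "x \<in> K \<times> {False} \<union> S \<times> {True}" and "y \<in> V \<times> UNIV" and "implication R x y \<noteq> 0"
    then have y: "fst y \<in> K \<union> S" and xy: "snd x \<noteq> snd y"
      "if snd x then R (fst x) (fst y) else fst x \<noteq> fst y \<and> \<not> R (fst x) (fst y)"
      unfolding V(1) implication_def by auto
    show "y \<in> K \<times> {False} \<union> S \<times> {True}"
    proof (cases "snd x")
      case True
      then have "fst y \<notin> S" using x xy S by auto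
      then show ?thesis using y xy True by (cases y) auto
    next
      case False
      then have "fst y \<notin> K" using x xy K by auto
      then show ?thesis using y xy False by (cases y) auto
    qed
  qed (use V(1) in auto)
  then have "(v, False) \<in> K \<times> {False} \<union> S \<times> {True}" "(v, True) \<in> K \<times> {False} \<union> S \<times> {True}"
    using \<open>v \<in> V\<close> by blast+
  then show False using V by auto
qed

text \<open>
  From a nontrivial closed set \<open>X\<close> one keeps the literals whose negation is not in \<open>X\<close>: by
  contraposition these are again closed. If none were kept, \<open>X\<close> would contain both literals of some
  vertices and none of the others; but two distinct vertices are adjacent or not, and either way an
  implication leads out of \<open>X\<close>.
\<close>

lemma reducible_consistent_closed_set:
  assumes "symp R" and red: "\<not> irreducible_on (V \<times> UNIV) (implication R)"
  obtains Y where "Y \<subseteq> V \<times> UNIV" "Y \<noteq> {}"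
    "\<And>x. x \<in> Y \<Longrightarrow> negate x \<notin> Y"
    "\<And>x y. x \<in> Y \<Longrightarrow> y \<in> V \<times> UNIV \<Longrightarrow> implication R x y \<noteq> 0 \<Longrightarrow> y \<in> Y"
proof -
  let ?U = "V \<times> (UNIV :: bool set)"
  obtain X where X: "X \<subseteq> ?U" "X \<noteq> {}" "X \<noteq> ?U"
    and closed: "\<And>x y. x \<in> X \<Longrightarrow> y \<in> ?U \<Longrightarrow> implication R x y \<noteq> 0 \<Longrightarrow> y \<in> X"
    using red unfolding irreducible_on_def by metis
  have negate_U: "negate x \<in> ?U \<longleftrightarrow> x \<in> ?U" for x by (cases x) simp
  define Y where "Y = {x \<in> X. negate x \<notin> X}"
  show ?thesis
  proof (rule that[of Y])
    show "Y \<noteq> {}"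
    proof
      assume "Y = {}"
      then have sat: "negate x \<in> X" if "x \<in> X" for x
        using that \<open>Y = {}\<close> unfolding Y_def by blast
      obtain a b where a: "(a, b) \<in> X" using X(2) by fast
      obtain c d where c: "(c, d) \<in> ?U" "(c, d) \<notin> X" using X(1,3) by fast
      have both: "(a, e) \<in> X" for e
        using a sat[OF a] by (cases "e = b") auto
      have neither: "(c, e) \<notin> X" for e
        using c(2) sat[of "(c, e)"] by (cases "e = d") auto
      have "a \<noteq> c" using both neither by blast
      show False
      proof (cases "R a c")
        case True
        then show False
          using closed[OF both, of "(c, False)" True] neither c(1) by (auto simp: implication_def)
      next
        case False
        then show False
          using closed[OF both, of "(c, True)" False] neither c(1) \<open>a \<noteq> c\<close> by (auto simp: implication_def)
      qed
    qed
    show "y \<in> Y" if "x \<in> Y" "y \<in> ?U" "implication R x y \<noteq> 0" for x y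
    proof -
      have "y \<in> X" using closed[of x y] that by (simp add: Y_def)
      moreover have "negate y \<notin> X"
      proof
        assume "negate y \<in> X"
        then have "negate x \<in> X"
          using closed[of "negate y" "negate x"] that X(1) negate_U[of x]
            implication_contrapositive[OF assms(1), of y x] unfolding Y_def by auto
        then show False using that(1) by (simp add: Y_def)
      qed
      ultimately show ?thesis by (simp add: Y_def)
    qed
  qed (use X(1) in \<open>auto simp: Y_def\<close>)
qed

lemma split_on_subset:
  assumes "split_on R V" and "W \<subseteq> V"
  shows "split_on R W"
proof -
  obtain K S where "V = K \<union> S" "K \<inter> S = {}"
    "\<forall>u\<in>K. \<forall>v\<in>K. u \<noteq> v \<longrightarrow> R u v" "\<forall>u\<in>S. \<forall>v\<in>S. \<not> R u v"
    using assms(1) unfolding split_on_def by (elim exE conjE)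
  then show ?thesis
    unfolding split_on_def using assms(2)
    by - (rule exI[of _ "K \<inter> W"], rule exI[of _ "S \<inter> W"], auto)
qed

text \<open>
  A clique that is joined to everything outside \<open>S'\<close>, and an independent set that is joined to
  nothing outside \<open>K'\<close>, can be added to any splitting of the remaining vertices.
\<close>

lemma split_on_extend:
  assumes R: "symp R" and W: "split_on R W" and V: "V = W \<union> K' \<union> S'" "K' \<inter> S' = {}"
    and K': "\<And>u v. u \<in> K' \<Longrightarrow> v \<in> V \<Longrightarrow> v \<notin> S' \<Longrightarrow> u \<noteq> v \<Longrightarrow> R u v"
    and S': "\<And>u v. u \<in> S' \<Longrightarrow> v \<in> V \<Longrightarrow> v \<notin> K' \<Longrightarrow> \<not> R u v"
  shows "split_on R V"
proof -
  obtain K S where KS: "W = K \<union> S" "K \<inter> S = {}"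
    and K: "\<forall>u\<in>K. \<forall>v\<in>K. u \<noteq> v \<longrightarrow> R u v" and S: "\<forall>u\<in>S. \<forall>v\<in>S. \<not> R u v"
    using W unfolding split_on_def by (elim exE conjE)
  have sym: "R u v \<longleftrightarrow> R v u" for u v using R by (meson sympD)
  show ?thesis unfolding split_on_def
  proof (rule exI[of _ "K - S' \<union> K'"], rule exI[of _ "S - K' \<union> S'"], intro conjI ballI impI)
    show "V = (K - S' \<union> K') \<union> (S - K' \<union> S')" using V KS by auto
    show "(K - S' \<union> K') \<inter> (S - K' \<union> S') = {}" using V KS by auto
    fix u v assume "u \<in> K - S' \<union> K'" "v \<in> K - S' \<union> K'" "u \<noteq> v"
    then show "R u v"
      using K K'[of u v] K'[of v u] sym[of u v] V KS by auto
  next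
    fix u v assume "u \<in> S - K' \<union> S'" "v \<in> S - K' \<union> S'"
    then show "\<not> R u v"
      using S S'[of u v] S'[of v u] sym[of u v] V KS by auto
  qed
qed

text \<open>
  A consistent closed set \<open>Y\<close> makes the matrix block triangular, with diagonal blocks for the
  negations of \<open>Y\<close>, for the literals of the untouched vertices, and for \<open>Y\<close> itself. Contraposition
  identifies the first block with the transpose of the last, so together they contribute a square to
  the characteristic polynomial. On the side of the graph, \<open>Y\<close> assigns its vertices to
  the clique or to the independent set without restricting the other vertices.
\<close>

lemma split_off_consistent_literals:
  fixes xs :: "'a list"
  assumes R: "symp R" and xs: "distinct xs"
    and red: "\<not> irreducible_on (set xs \<times> UNIV) (implication R)"
  obtains ws where "distinct ws" "length ws < length xs"
    "is_square (list_char_poly (lits xs) (implication R)) \<longleftrightarrow>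
       is_square (list_char_poly (lits ws) (implication R))"
    "split_on R (set xs) \<longleftrightarrow> split_on R (set ws)"
proof -
  obtain Y where Y: "Y \<subseteq> set xs \<times> UNIV" "Y \<noteq> {}"
    and consistent: "\<And>x. x \<in> Y \<Longrightarrow> negate x \<notin> Y"
    and closed: "\<And>x y. x \<in> Y \<Longrightarrow> y \<in> set xs \<times> UNIV \<Longrightarrow> implication R x y \<noteq> 0 \<Longrightarrow> y \<in> Y"
    using reducible_consistent_closed_set[OF R red] by metis
  define ys where "ys = filter (\<lambda>x. x \<in> Y) (lits xs)"
  define ws where "ws = filter (\<lambda>v. \<forall>b. (v, b) \<notin> Y) xs"
  have set_ys: "set ys = Y" using Y(1) by (auto simp: ys_def set_lits)
  have set_ws: "v \<in> set ws \<longleftrightarrow> v \<in> set xs \<and> (v, False) \<notin> Y \<and> (v, True) \<notin> Y" for v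
    by (auto simp: ws_def) (metis (full_types))+
  let ?t = "implication R"
  have dist: "distinct (lits xs)" "distinct ws" "distinct ys"
    using xs distinct_lits[OF xs] by (auto simp: ws_def ys_def)
  have dist_neg: "distinct (map negate ys)"
    using dist(3) by (simp add: distinct_map inj_on_def) (metis negate_negate)
  have disj: "Y \<inter> negate ` Y = {}" using consistent by blast
  have disj': "set (lits ws) \<inter> Y = {}" "negate ` Y \<inter> set (lits ws) = {}"
    using set_ws by (auto simp: set_lits) (metis (full_types))+
  have sets: "set (lits xs) = negate ` Y \<union> (set (lits ws) \<union> Y)"
  proof -
    have "(v, b) \<in> negate ` Y \<longleftrightarrow> (v, \<not> b) \<in> Y" for v b
      by (metis imageE imageI negate_Pair negate_negate)
    then show ?thesis
      using Y(1) set_ws by (auto simp: set_lits) (metis (full_types))+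
  qed
  have "mset (lits xs) = mset (map negate ys @ lits ws @ ys)"
    using dist dist_neg distinct_lits[OF dist(2)] disj disj' sets set_ys
    by (subst set_eq_iff_mset_eq_distinct[symmetric]) auto
  then have "list_char_poly (lits xs) ?t = list_char_poly (map negate ys @ lits ws @ ys) ?t"
    by (rule list_char_poly_perm)
  also have "\<dots> = list_char_poly (map negate ys) ?t * list_char_poly (lits ws @ ys) ?t"
  proof (rule list_char_poly_append)
    fix x y assume x: "x \<in> set (map negate ys)" and y: "y \<in> set (lits ws @ ys)"
    show "?t y x = 0"
    proof (rule ccontr)
      assume "?t y x \<noteq> 0"
      then have "?t (negate x) (negate y) \<noteq> 0" by (simp add: implication_contrapositive[OF R])
      moreover have "negate x \<in> Y" using x set_ys by auto
      moreover have "negate y \<in> set xs \<times> UNIV"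
      proof -
        have "y \<in> set xs \<times> UNIV" using y sets set_ys set_lits[of xs] by auto
        then show ?thesis by (cases y) auto
      qed
      ultimately have "negate y \<in> Y" using closed[of "negate x" "negate y"] by simp
      then have "y \<in> negate ` Y" by (metis imageI negate_negate)
      then show False using y disj disj' set_ys by auto
    qed
  qed
  also have "list_char_poly (lits ws @ ys) ?t = list_char_poly (lits ws) ?t * list_char_poly ys ?t"
  proof (rule list_char_poly_append)
    fix x y assume "x \<in> set (lits ws)" "y \<in> set ys"
    then show "?t y x = 0"
      using closed[of y x] set_ys disj' sets by (auto simp: set_lits)
  qed
  also have "list_char_poly (map negate ys) ?t = list_char_poly ys ?t"
    unfolding list_char_poly_map implication_contrapositive[OF R] by (rule list_char_poly_transpose)
  finally have "list_char_poly (lits xs) ?t =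
      list_char_poly ys ?t ^ 2 * list_char_poly (lits ws) ?t"
    by (simp add: power2_eq_square mult_ac)
  then have square: "is_square (list_char_poly (lits xs) ?t) \<longleftrightarrow>
      is_square (list_char_poly (lits ws) ?t)"
    by (simp add: is_nth_power_mult_cancel_left)
  have "length ws < length xs"
  proof -
    obtain v b where "(v, b) \<in> Y" using Y(2) by fast
    then show ?thesis
      unfolding ws_def using Y(1) by (intro length_filter_less[of v]) auto
  qed
  moreover have "split_on R (set xs) \<longleftrightarrow> split_on R (set ws)"
  proof
    assume "split_on R (set xs)"
    then show "split_on R (set ws)" by (rule split_on_subset) (simp add: ws_def)
  next
    define K where "K = {v. (v, False) \<in> Y}"
    define S where "S = {v. (v, True) \<in> Y}"
    assume "split_on R (set ws)"
    then show "split_on R (set xs)"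
    proof (rule split_on_extend[OF R])
      show "set xs = set ws \<union> K \<union> S"
        using Y(1) set_ws by (auto simp: K_def S_def)
      show "K \<inter> S = {}" using consistent[of "(v, False)" for v] by (auto simp: K_def S_def)
      show "R u v" if "u \<in> K" "v \<in> set xs" "v \<notin> S" "u \<noteq> v" for u v
        using closed[of "(u, False)" "(v, True)"] that by (auto simp: K_def S_def implication_def)
      show "\<not> R u v" if "u \<in> S" "v \<in> set xs" "v \<notin> K" for u v
        using closed[of "(u, True)" "(v, False)"] that by (auto simp: K_def S_def implication_def)
    qed
  qed
  ultimately show ?thesis using that[of ws] dist(2) square by blast
qed

theorem split_on_iff_square:
  assumes R: "symp R" and "distinct xs"
  shows "split_on R (set xs) \<longleftrightarrow> is_square (list_char_poly (lits xs) (implication R))"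
  using assms(2)
proof (induction xs rule: length_induct)
  case (1 xs)
  consider "xs = []" | "xs \<noteq> []" "irreducible_on (set xs \<times> UNIV) (implication R)"
    | "\<not> irreducible_on (set xs \<times> UNIV) (implication R)" by blast
  then show ?case
  proof cases
    case 1
    have "list_char_poly (lits []) (implication R) = 1"
      by (simp add: list_char_poly_def list_mat_def lits_def char_poly_def char_poly_matrix_def)
    then show ?thesis using 1 by (simp add: split_on_def)
  next
    case 2
    have "\<not> is_square (list_char_poly (lits xs) (implication R))"
    proof (rule irreducible_char_poly_not_square)
      show "distinct (lits xs)" using 1(2) by (rule distinct_lits)
      show "lits xs \<noteq> []" using 2(1) by (simp add: lits_def)
      show "implication R i j \<ge> 0" for i j by (simp add: implication_def)
      show "irreducible_on (set (lits xs)) (implication R)" using 2(2) by (simp add: set_lits)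
    qed
    then show ?thesis using irreducible_not_split_on[OF 2(2)] 2(1) by simp
  next
    case 3
    obtain ws where "distinct ws" "length ws < length xs"
      "is_square (list_char_poly (lits xs) (implication R)) \<longleftrightarrow>
         is_square (list_char_poly (lits ws) (implication R))"
      "split_on R (set xs) \<longleftrightarrow> split_on R (set ws)"
      using split_off_consistent_literals[OF R 1(2) 3] by metis
    then show ?thesis using 1(1) by blast
  qed
qed

section \<open>The characterisation of split graphs\<close>

lemma split_graph_iff_split_on:
  "split_graph G \<longleftrightarrow> split_on (\<lambda>u v. (u, v) \<in> parcs G) (pverts G)"
proof -
  have "pverts G = K \<union> S \<and> K \<inter> S = {} \<and> clique G K \<and> independent_set G S \<longleftrightarrow>
    pverts G = K \<union> S \<and> K \<inter> S = {} \<and> (\<forall>u\<in>K. \<forall>v\<in>K. u \<noteq> v \<longrightarrow> (u, v) \<in> parcs G) \<and>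
      (\<forall>u\<in>S. \<forall>v\<in>S. (u, v) \<notin> parcs G)" for K S
    unfolding clique_def independent_set_def by auto
  then show ?thesis unfolding split_graph_def split_on_def by simp
qed

theorem theorem2p1:
  fixes n :: nat and G :: "nat pair_pre_digraph"
  assumes "n \<ge> 1" and "pair_graph G" and "pverts G = {1..n}"
  shows "split_graph G \<longleftrightarrow>
    is_square (det ([:0, 1:] \<cdot>\<^sub>m 1\<^sub>m (2 * n) - map_mat (\<lambda>a. [:a:]) (T_mat n G)))"
proof -
  interpret pair_graph G by fact
  define R where "R u v \<longleftrightarrow> (u, v) \<in> parcs G" for u v
  have "symp R" using arcs_symmetric by (auto simp: symp_def R_def)
  define xs where "xs = [1..<n + 1]"
  have xs: "set xs = pverts G" "distinct xs"
    unfolding xs_def assms(3) set_upt by force simp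
  have len: "length xs = n" and nth: "\<And>i. i < n \<Longrightarrow> xs ! i = i + 1"
    by (simp_all add: xs_def nth_upt del: upt_Suc)
  have "T_mat n G = list_mat (lits xs) (implication R)"
  proof (rule eq_matI)
    fix i j
    assume "i < dim_row (list_mat (lits xs) (implication R))" "j < dim_col (list_mat (lits xs) (implication R))"
    then have ij: "i < 2 * n" "j < 2 * n" by (simp_all add: len)
    then show "T_mat n G $$ (i, j) = list_mat (lits xs) (implication R) $$ (i, j)"
      by (cases "i < n"; cases "j < n")
        (simp_all add: T_mat_def adj_mat_def len lits_nth nth implication_def compl_graph_def R_def assms(3))
  qed (simp_all add: T_mat_def adj_mat_def len)
  moreover have "split_graph G \<longleftrightarrow> split_on R (set xs)"
    unfolding xs(1) R_def by (rule split_graph_iff_split_on)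
  ultimately show ?thesis
    using split_on_iff_square[OF \<open>symp R\<close> xs(2)]
    unfolding char_poly_T_mat[symmetric] by (simp add: list_char_poly_def)
qed

end
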